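(* Let $r\ge k\ge 2$ be integers, let $\Delta=r-k$, and let $T$ be a tight $k$-tree such that $\bigcap_{e\in E(T)}e=\emptyset$. There exist constants $0<c<C$ and functions $\varepsilon_1(n),\varepsilon_2(n),\varepsilon_3(n)$ tending to $0$ as $n\to\infty$ (all depending only on $r$ and $T$) such that, for $p=p(n)\in[0,1]$: (1) if $p\ge n^{-\Delta+\varepsilon_1(n)}$, then asymptotically almost surely $c\,pn^{r-1}\le \mathrm{ex}(G^r_{n,p},T^{(+r)})\le C\,pn^{r-1}$; (2) if $n^{-\Delta-1+\varepsilon_2(n)}\le p\le n^{-\Delta+\varepsilon_1(n)}$, then asymptotically almost surely $$n^{k-1-\varepsilon_3(n)}\le \mathrm{ex}(G^r_{n,p},T^{(+r)})\le n^{k-1+\varepsilon_3(n)}.$$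
   Context: An $r$-graph is a hypergraph all of whose edges have size $r$. A $k$-graph $T$ is a tight $k$-tree if its edges can be ordered $e_1,\dots,e_t$ so that for every $i\ge 2$ there exist $v\in e_i$ and $1\le s\le i-1$ with $v\notin\bigcup_{j=1}^{i-1}e_j$ and $e_i\setminus\{v\}\subset e_s$. For a $k$-graph $H$ and $r\ge k$, the $r$-expansion $H^{(+r)}$ is the $r$-graph obtained from $H$ by enlarging each edge of $H$ by a set of $r-k$ new vertices of degree one (the sets added to different edges being disjoint); $H^{(+k)}=H$. $G^r_{n,p}$ is the random $r$-graph on $n$ vertices in which each $r$-set is an edge independently with probability $p$. $\mathrm{ex}(G^r_{n,p},H)$ is the maximum number of edges in an $H$-free subgraph of $G^r_{n,p}$. A statement depending on $n$ holds asymptotically almost surely if its probability tends to $1$ as $n\to\infty$. *)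

theory Defs
  imports "HOL-Probability.Probability"
begin

text \<open>
  A hypergraph is identified with its set of edges; its vertices are the elements of the edges.
\<close>

definition uniform_hypergraph :: "nat \<Rightarrow> 'a set set \<Rightarrow> bool" where
  "uniform_hypergraph k H \<longleftrightarrow> (\<forall>e\<in>H. finite e \<and> card e = k)"

definition tight_tree :: "nat \<Rightarrow> 'a set set \<Rightarrow> bool" where
  "tight_tree k T \<longleftrightarrow>
     uniform_hypergraph k T \<and>
     (\<exists>es. es \<noteq> [] \<and> distinct es \<and> set es = T \<and>
        (\<forall>i. 1 \<le> i \<and> i < length es \<longrightarrow>
           (\<exists>v\<in>es ! i. \<exists>s<i. v \<notin> (\<Union>j<i. es ! j) \<and> es ! i - {v} \<subseteq> es ! s)))"

text \<open>
  The old vertices are tagged with \<open>Inl\<close>; the new vertices added to the edge \<open>e\<close> are the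
  \<open>Inr (e, i)\<close> with \<open>i < r - card e\<close>, so different edges receive disjoint sets of new vertices.
  For a \<open>k\<close>-uniform hypergraph each edge receives \<open>r - k\<close> of them.
\<close>

definition expansion :: "nat \<Rightarrow> 'a set set \<Rightarrow> ('a + 'a set \<times> nat) set set" where
  "expansion r H = (\<lambda>e. Inl ` e \<union> Inr ` ({e} \<times> {..<r - card e})) ` H"

text \<open>Copies of \<open>H\<close> need not be induced.\<close>

definition contains_copy :: "'b set set \<Rightarrow> 'a set set \<Rightarrow> bool" where
  "contains_copy G H \<longleftrightarrow> (\<exists>f. inj_on f (\<Union>H) \<and> (\<forall>e\<in>H. f ` e \<in> G))"

text \<open>Meant for a finite host \<open>G\<close> and a nonempty \<open>H\<close>, so that the maximum exists.\<close>

definition ex_number :: "'b set set \<Rightarrow> 'a set set \<Rightarrow> nat" where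
  "ex_number G H = Max {card F | F. F \<subseteq> G \<and> \<not> contains_copy F H}"

definition complete_hypergraph :: "nat \<Rightarrow> nat \<Rightarrow> nat set set" where
  "complete_hypergraph r n = {e. e \<subseteq> {..<n} \<and> card e = r}"

definition random_hypergraph :: "nat \<Rightarrow> nat \<Rightarrow> real \<Rightarrow> nat set set pmf" where
  "random_hypergraph r n p =
     map_pmf (\<lambda>\<omega>. {e \<in> complete_hypergraph r n. \<omega> e})
       (Pi_pmf (complete_hypergraph r n) False (\<lambda>_. bernoulli_pmf p))"

definition asymptotically_almost_surely ::
    "(nat \<Rightarrow> 'a pmf) \<Rightarrow> (nat \<Rightarrow> 'a \<Rightarrow> bool) \<Rightarrow> bool" where
  "asymptotically_almost_surely M P \<longleftrightarrow>
     (\<lambda>n. measure_pmf.prob (M n) {x. P n x}) \<longlonglongrightarrow> 1"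

end

(* All upper bounds come from degrees. If every k-set lies in at most D edges of F, discard greedily the
   edges through (k-1)-sets of degree at most L = v(T^(+r)) * D. If anything survives, T^(+r) embeds edge
   by edge: the image of e_i - {v} is a (k-1)-set of large degree, and at most L of the edges containing it
   meet the part of the embedding already built. So an F without T^(+r) has at most L n^(k-1) edges.
   By Chernoff and a union bound, D = O(max(p n^Delta, (log n)^2)) in the random hypergraph.

   For the lower bounds, a star contains no T^(+r) since the edges of T have no common vertex. When p is
   small, take instead a maximal family of edges meeting pairwise in fewer than k-1 vertices: it contains
   no T^(+r), since consecutive edges of a tight tree share k-1 vertices, and it has order n^(k-1) edges,
   because each of its edges blocks only O(p n^(Delta+1)) others. *)

theory Submission
  imports Defs "HOL-Real_Asymp.Real_Asymp"
begin

section \<open>Degrees and embeddings\<close>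

definition codegree :: "'a set set \<Rightarrow> 'a set \<Rightarrow> nat" where
  "codegree F \<sigma> = card {e \<in> F. \<sigma> \<subseteq> e}"

definition shadow :: "nat \<Rightarrow> 'a set set \<Rightarrow> 'a set set" where
  "shadow j F = {\<sigma>. card \<sigma> = j \<and> (\<exists>e\<in>F. \<sigma> \<subseteq> e)}"

lemma finite_shadow:
  assumes "finite F" "uniform_hypergraph r F"
  shows "finite (shadow j F)"
proof (rule finite_subset)
  show "shadow j F \<subseteq> Pow (\<Union>F)" by (auto simp: shadow_def)
  show "finite (Pow (\<Union>F))" using assms by (auto simp: uniform_hypergraph_def)
qed

lemma shadow_mono: "F \<subseteq> G \<Longrightarrow> shadow j F \<subseteq> shadow j G"
  by (auto simp: shadow_def)

lemma uniform_hypergraph_subset: "F \<subseteq> G \<Longrightarrow> uniform_hypergraph r G \<Longrightarrow> uniform_hypergraph r F"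
  by (auto simp: uniform_hypergraph_def)

text \<open>Deleting all edges through a shadow set of codegree at most \<open>L\<close> costs at
  most \<open>L\<close> edges and removes at least that set from the shadow, so the strict
  inequality between edges and \<open>L\<close> times the shadow survives. It fails for the empty
  family, so the process stops at a nonempty one.\<close>

lemma subhypergraph_min_codegree:
  assumes "finite F" "uniform_hypergraph r F" "card F > L * card (shadow j F)"
  shows "\<exists>F'\<subseteq>F. F' \<noteq> {} \<and> (\<forall>\<sigma>\<in>shadow j F'. codegree F' \<sigma> > L)"
  using assms
proof (induction "card F" arbitrary: F rule: less_induct)
  case less
  show ?case
  proof (cases "\<forall>\<sigma>\<in>shadow j F. codegree F \<sigma> > L")
    case True
    then show ?thesis using less.prems by (intro exI[of _ F]) auto
  next
    case False
    then obtain \<sigma> where \<sigma>: "\<sigma> \<in> shadow j F" "codegree F \<sigma> \<le> L" by force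
    define F2 where "F2 = {e\<in>F. \<not> \<sigma> \<subseteq> e}"
    have F2: "F2 \<subseteq> F" "F2 \<noteq> F" using \<sigma>(1) by (auto simp: F2_def shadow_def)
    have fin2: "finite F2" using F2 less.prems finite_subset by blast
    have lt: "card F2 < card F" using F2 less.prems by (simp add: psubset_card_mono psubset_eq)
    have "F = F2 \<union> {e\<in>F. \<sigma> \<subseteq> e}" "F2 \<inter> {e\<in>F. \<sigma> \<subseteq> e} = {}" by (auto simp: F2_def)
    then have "card F = card F2 + codegree F \<sigma>"
      using less.prems(1) fin2 unfolding codegree_def
      by (metis (no_types, lifting) card_Un_disjoint finite_Un)
    then have c1: "card F \<le> card F2 + L" using \<sigma> by simp
    have finS: "finite (shadow j F)" using finite_shadow less.prems by blast
    have "\<sigma> \<notin> shadow j F2" by (auto simp: F2_def shadow_def)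
    then have "shadow j F2 \<subset> shadow j F" using shadow_mono[OF F2(1), of j] \<sigma>(1) by blast
    then have "card (shadow j F2) < card (shadow j F)"
      using finS by (simp add: psubset_card_mono)
    then have "L * (card (shadow j F2) + 1) \<le> L * card (shadow j F)" by (intro mult_le_mono2) simp
    then have "card F2 > L * card (shadow j F2)" using c1 less.prems(3) by simp
    with less.hyps[OF lt fin2 uniform_hypergraph_subset[OF F2(1) less.prems(2)]]
    obtain F' where "F' \<subseteq> F2" "F' \<noteq> {}" "\<forall>\<sigma>\<in>shadow j F'. codegree F' \<sigma> > L" by auto
    then show ?thesis using F2(1) by blast
  qed
qed

text \<open>An edge through \<open>\<sigma>\<close> that meets \<open>W\<close> outside
  \<open>\<sigma>\<close> contains \<open>insert w \<sigma>\<close> for some \<open>w\<close> in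
  \<open>W - \<sigma>\<close>. There are at most \<open>m * D\<close> such edges, too few to exhaust
  the edges through \<open>\<sigma>\<close>. In the embedding, \<open>W\<close> is the part of the
  host already occupied.\<close>

lemma edge_avoiding_set:
  assumes "finite F" "finite W" "card W \<le> m"
    and card: "card \<sigma> = j"
    and big: "codegree F \<sigma> > m * D"
    and deg: "\<And>\<tau>. card \<tau> = Suc j \<Longrightarrow> codegree F \<tau> \<le> D"
    and "finite \<sigma>"
  shows "\<exists>f\<in>F. \<sigma> \<subseteq> f \<and> f \<inter> W \<subseteq> \<sigma>"
proof (rule ccontr)
  assume neg: "\<not> ?thesis"
  have "{e\<in>F. \<sigma> \<subseteq> e} \<subseteq> (\<Union>w\<in>W - \<sigma>. {e\<in>F. insert w \<sigma> \<subseteq> e})"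
    using neg by blast
  then have "codegree F \<sigma> \<le> card (\<Union>w\<in>W - \<sigma>. {e\<in>F. insert w \<sigma> \<subseteq> e})"
    unfolding codegree_def using assms(1,2) by (intro card_mono) auto
  also have "\<dots> \<le> (\<Sum>w\<in>W - \<sigma>. card {e\<in>F. insert w \<sigma> \<subseteq> e})"
    using assms(2) by (intro card_UN_le) auto
  also have "\<dots> \<le> (\<Sum>w\<in>W - \<sigma>. D)"
  proof (rule sum_mono)
    fix w assume "w \<in> W - \<sigma>"
    then have "card (insert w \<sigma>) = Suc j" using card \<open>finite \<sigma>\<close> by simp
    from deg[OF this] show "card {e\<in>F. insert w \<sigma> \<subseteq> e} \<le> D" by (simp add: codegree_def)
  qed
  also have "\<dots> = card (W - \<sigma>) * D" by simp
  also have "\<dots> \<le> m * D" using assms(2,3) by (intro mult_le_mono1) (meson card_Diff_subset_Int card_mono Diff_subset le_trans)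
  finally show False using big by simp
qed

section \<open>Greedy embedding of expanded tight trees\<close>

text \<open>The map whose image is taken in \<open>expansion\<close>, named so that the expanded
  edges can be handled one at a time in the order of the tree.\<close>

definition expanded_edge :: "nat \<Rightarrow> 'a set \<Rightarrow> ('a + 'a set \<times> nat) set" where
  "expanded_edge r e = Inl ` e \<union> Inr ` ({e} \<times> {..<r - card e})"

lemma expansion_eq: "expansion r H = expanded_edge r ` H"
  by (simp add: expansion_def expanded_edge_def)

lemma finite_expanded_edge: "finite e \<Longrightarrow> finite (expanded_edge r e)"
  by (simp add: expanded_edge_def)

lemma card_expanded_edge:
  assumes "finite e" "card e \<le> r"
  shows "card (expanded_edge r e) = r"
proof -
  have "card (expanded_edge r e) = card (Inl ` e :: ('a + 'a set \<times> nat) set) + card (Inr ` ({e} \<times> {..<r - card e}) :: ('a + 'a set \<times> nat) set)"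
    unfolding expanded_edge_def using assms by (intro card_Un_disjoint) auto
  then show ?thesis using assms by (simp add: card_image card_cartesian_product)
qed

lemma inj_expanded_edge: "inj (expanded_edge r)"
proof (rule injI)
  fix e e' :: "'a set" assume "expanded_edge r e = expanded_edge r e'"
  then have "Inl -` expanded_edge r e = Inl -` expanded_edge r e'" by simp
  then show "e = e'" by (auto simp: expanded_edge_def vimage_def)
qed

text \<open>The edges are placed in the order of the tight tree. The old part
  \<open>e_i - {v}\<close> of the next edge lies in an earlier edge, so its image lies in the
  (k-1)-shadow and has large codegree. Some edge of \<open>F\<close> through it avoids the rest of
  the image, and \<open>v\<close> together with the \<open>r - k\<close> new vertices is sent to the
  remainder of that edge.\<close>

lemma embed_expanded_tree:
  fixes T :: "'a set set" and F :: "'b set set"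
  assumes "2 \<le> k" "k \<le> r" "tight_tree k T" "finite F" "uniform_hypergraph r F" "F \<noteq> {}"
    and big: "\<And>\<sigma>. \<sigma> \<in> shadow (k - 1) F \<Longrightarrow> codegree F \<sigma> > card (\<Union>(expansion r T)) * D"
    and deg: "\<And>\<tau>. card \<tau> = k \<Longrightarrow> codegree F \<tau> \<le> D"
  shows "contains_copy F (expansion r T)"
proof -
  let ?X = "expanded_edge r"
  from assms(3) obtain es where es: "es \<noteq> []" "distinct es" "set es = T" and
    step: "\<And>i. 1 \<le> i \<Longrightarrow> i < length es \<Longrightarrow>
           \<exists>v\<in>es ! i. \<exists>s<i. v \<notin> (\<Union>j<i. es ! j) \<and> es ! i - {v} \<subseteq> es ! s"
    and unif: "uniform_hypergraph k T"
    unfolding tight_tree_def by metis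
  have fin: "finite (es ! i)" "card (es ! i) = k" if "i < length es" for i
    using that es(3) unif by (auto simp: uniform_hypergraph_def)
  let ?V = "\<lambda>i. \<Union>j<i. ?X (es ! j)"
  have VT: "?V i \<subseteq> \<Union>(expansion r T)" if "i \<le> length es" for i
    using that es(3) by (fastforce simp: expansion_eq)
  have finVT: "finite (\<Union>(expansion r T))"
    using es(3) unif by (auto simp: expansion_eq uniform_hypergraph_def finite_expanded_edge)
  \<comment> \<open>Embeddings of the first \<open>i\<close> expanded edges. The induction starts at
    1 because the first edge has no predecessor to attach to and may be mapped to any edge of
    \<open>F\<close>.\<close>
  have "\<exists>g. inj_on g (?V i) \<and> (\<forall>j<i. g ` ?X (es ! j) \<in> F)" if "1 \<le> i" "i \<le> length es" for i
    using that
  proof (induction i rule: nat_induct_at_least)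
    case base
    obtain f where f: "f \<in> F" using assms by auto
    then have "card f = card (?X (es ! 0))" "finite f"
      using card_expanded_edge[of "es!0" r] fin[of 0] assms es by (auto simp: uniform_hypergraph_def)
    then obtain h where "bij_betw h (?X (es ! 0)) f"
      using fin[of 0] es(1) finite_same_card_bij[of "?X (es ! 0)" f] finite_expanded_edge by auto
    then show ?case using f by (intro exI[of _ h]) (auto simp: bij_betw_def lessThan_Suc)
  next
    case (Suc i)
    then obtain g where g: "inj_on g (?V i)" "\<And>j. j < i \<Longrightarrow> g ` ?X (es ! j) \<in> F" by auto
    let ?e = "es ! i"
    obtain v s where v: "v \<in> ?e" "s < i" "v \<notin> (\<Union>j<i. es ! j)" "?e - {v} \<subseteq> es ! s"
      using step[of i] Suc.hyps Suc.prems by auto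
    \<comment> \<open>The \<open>k - 1\<close> vertices of the new expanded edge that are already
      placed.\<close>
    define A :: "('a + 'a set \<times> nat) set" where "A = Inl ` (?e - {v})"
    define \<sigma> where "\<sigma> = g ` A"
    have ilt: "i < length es" using Suc.prems by simp
    have As: "A \<subseteq> ?X (es ! s)" using v(4) by (auto simp: A_def expanded_edge_def)
    have AV: "A \<subseteq> ?V i" using As v(2) by blast
    have finA: "finite A" "card A = k - 1"
      using fin[OF ilt] v(1) by (auto simp: A_def card_image)
    have \<sigma>: "finite \<sigma>" "card \<sigma> = k - 1"
      using finA inj_on_subset[OF g(1) AV] by (auto simp: \<sigma>_def card_image)
    have "\<sigma> \<subseteq> g ` ?X (es ! s)" using As by (auto simp: \<sigma>_def)
    then have sh: "\<sigma> \<in> shadow (k - 1) F" using \<sigma>(2) g(2)[OF v(2)] by (auto simp: shadow_def)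
    have finV: "finite (?V i)" using fin Suc.prems by (auto intro!: finite_expanded_edge)
    have cW: "card (g ` ?V i) \<le> card (\<Union>(expansion r T))"
      using card_image_le[OF finV, of g] card_mono[OF finVT VT[of i]] Suc.prems by linarith
    \<comment> \<open>The set to avoid is the whole image built so far. Its size is at most the
      number of vertices of the expansion, which is the factor in front of \<open>D\<close> in
      \<open>big\<close>.\<close>
    obtain f where f: "f \<in> F" "\<sigma> \<subseteq> f" "f \<inter> g ` ?V i \<subseteq> \<sigma>"
      using edge_avoiding_set[OF assms(4) _ cW \<sigma>(2) big[OF sh] _ \<sigma>(1)] deg finV assms(1) by auto
    have ff: "finite f" "card f = r" using f assms by (auto simp: uniform_hypergraph_def)
    define B where "B = ?X ?e - A"
    have AX: "A \<subseteq> ?X ?e" by (auto simp: A_def expanded_edge_def)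
    \<comment> \<open>The vertices of \<open>B\<close> are fresh: \<open>v\<close> by the tree
      ordering, and the tagged ones because they carry the name of an edge different from all
      earlier edges.\<close>
    have BV: "B \<inter> ?V i = {}"
    proof -
      have "Inl v \<notin> ?V i" using v(3) by (auto simp: expanded_edge_def)
      moreover have "Inr (?e, l) \<notin> ?V i" for l
      proof
        assume "Inr (?e, l) \<in> ?V i"
        then obtain j where "j < i" "?e = es ! j" by (auto simp: expanded_edge_def)
        then show False using es(2) ilt by (simp add: nth_eq_iff_index_eq)
      qed
      moreover have "B \<subseteq> insert (Inl v) (range (\<lambda>l. Inr (?e, l)))"
        by (auto simp: B_def A_def expanded_edge_def)
      ultimately have "x \<notin> ?V i" if "x \<in> B" for x
        using that by (elim subsetD[THEN insertE]) auto
      then show ?thesis by (meson disjoint_iff)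
    qed
    have "card B = card (f - \<sigma>)"
      using card_Diff_subset[OF finA(1) AX] card_Diff_subset[OF \<sigma>(1) f(2)] finA \<sigma> ff
        card_expanded_edge[of ?e r] fin[OF ilt] assms(2) by (simp add: B_def)
    moreover have "finite B" using fin[OF ilt] finite_expanded_edge by (auto simp: B_def)
    ultimately obtain h where h: "bij_betw h B (f - \<sigma>)"
      using finite_same_card_bij[of B "f - \<sigma>"] ff by auto
    \<comment> \<open>\<open>g\<close> is kept on the old vertices and extended by a bijection from
      the fresh vertices onto \<open>f - \<sigma>\<close>. Injectivity holds because
      \<open>f\<close> meets the old image only in \<open>\<sigma>\<close>.\<close>
    define g' where "g' = (\<lambda>x. if x \<in> B then h x else g x)"
    have g'V: "g' x = g x" if "x \<in> ?V i" for x using that BV by (auto simp: g'_def)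
    have g'B: "g' ` B = f - \<sigma>" using h by (auto simp: g'_def bij_betw_def)
    have img: "g' ` S = g ` S" if "S \<subseteq> ?V i" for S
      using that g'V by (intro image_cong) auto
    have Vs: "?V (Suc i) = ?V i \<union> B"
      using AV AX by (auto simp: B_def lessThan_Suc)
    have "inj_on g' (?V (Suc i))"
      unfolding Vs
    proof (rule inj_on_Un[THEN iffD2], intro conjI)
      show "inj_on g' (?V i)" using g(1) inj_on_cong[of "?V i" g' g] g'V by metis
      show "inj_on g' B" using h by (auto simp: bij_betw_def g'_def inj_on_def)
      show "g' ` (?V i - B) \<inter> g' ` (B - ?V i) = {}"
      proof -
        have "?V i - B = ?V i" "B - ?V i = B" using BV by auto
        moreover have "g' ` ?V i \<inter> g' ` B = {}"
          unfolding g'B img[OF order_refl] using f(3) by blast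
        ultimately show ?thesis by simp
      qed
    qed
    moreover have "g' ` ?X ?e = f"
    proof -
      have "?X ?e = A \<union> B" using AX by (auto simp: B_def)
      then have "g' ` ?X ?e = \<sigma> \<union> (f - \<sigma>)" using img[OF AV] g'B by (simp add: image_Un \<sigma>_def)
      then show ?thesis using f(2) by auto
    qed
    moreover have "g' ` ?X (es ! j) \<in> F" if "j < i" for j
    proof -
      have "?X (es ! j) \<subseteq> ?V i" using that by blast
      then show ?thesis using img g(2)[OF that] by simp
    qed
    ultimately show ?case using f(1) by (intro exI[of _ g']) (auto simp: less_Suc_eq)
  qed
  from this[of "length es"] es(1) obtain g where
    g: "inj_on g (?V (length es))" "\<And>j. j < length es \<Longrightarrow> g ` ?X (es ! j) \<in> F"
    by (auto simp: Suc_le_eq)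
  have "?V (length es) = \<Union>(expansion r T)"
    unfolding expansion_eq es(3)[symmetric] set_conv_nth by auto
  moreover have "\<forall>e\<in>expansion r T. g ` e \<in> F"
    using g(2) es(3) by (auto simp: expansion_eq in_set_conv_nth)
  ultimately show ?thesis using g(1) unfolding contains_copy_def by auto
qed

text \<open>With more edges than this, cleaning with \<open>L\<close> equal to the number of
  vertices of the expansion times \<open>D\<close> leaves a nonempty subfamily of large
  (k-1)-codegrees. Codegrees of k-sets only drop in a subfamily, so the greedy embedding
  applies.\<close>

lemma card_le_if_no_expanded_tree:
  fixes T :: "'a set set" and F :: "'b set set"
  assumes "2 \<le> k" "k \<le> r" "tight_tree k T" "finite F" "uniform_hypergraph r F"
    and deg: "\<And>\<tau>. card \<tau> = k \<Longrightarrow> codegree F \<tau> \<le> D"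
    and free: "\<not> contains_copy F (expansion r T)"
  shows "card F \<le> card (\<Union>(expansion r T)) * D * card (shadow (k - 1) F)"
proof (rule ccontr)
  assume "\<not> ?thesis"
  then obtain F' where F': "F' \<subseteq> F" "F' \<noteq> {}"
      "\<forall>\<sigma>\<in>shadow (k - 1) F'. codegree F' \<sigma> > card (\<Union>(expansion r T)) * D"
    using subhypergraph_min_codegree[OF assms(4,5)] by (meson not_le)
  have "codegree F' \<tau> \<le> D" if "card \<tau> = k" for \<tau>
  proof -
    have "codegree F' \<tau> \<le> codegree F \<tau>"
      unfolding codegree_def using F'(1) assms(4) by (intro card_mono) auto
    then show ?thesis using deg[OF that] by simp
  qed
  then have "contains_copy F' (expansion r T)"
    using F'(2,3) assms(1-3) finite_subset[OF F'(1) assms(4)]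
      uniform_hypergraph_subset[OF F'(1) assms(5)]
    by (intro embed_expanded_tree[of k r T F' D]) auto
  then show False using free F'(1) unfolding contains_copy_def by blast
qed

section \<open>Stars and packings contain no expanded tree\<close>

text \<open>In a copy inside a star, every expanded edge contains a preimage of the centre
  \<open>x\<close>, and by injectivity it is always the same vertex \<open>y\<close>. An old vertex
  \<open>y\<close> would lie in \<open>\<Inter>T\<close>.\<close>

lemma star_no_expansion:
  assumes "\<Inter>T = {}" "T \<noteq> {}" "uniform_hypergraph k T" "2 \<le> k"
    and star: "\<And>e. e \<in> F \<Longrightarrow> x \<in> e"
  shows "\<not> contains_copy F (expansion r T)"
proof
  assume "contains_copy F (expansion r T)"
  then obtain g where g: "inj_on g (\<Union>(expansion r T))" "\<And>e. e \<in> T \<Longrightarrow> g ` expanded_edge r e \<in> F"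
    by (auto simp: contains_copy_def expansion_eq)
  have ex: "\<exists>y\<in>expanded_edge r e. g y = x" if "e \<in> T" for e
    using star[OF g(2)[OF that]] by auto
  obtain e0 where e0: "e0 \<in> T" using assms by auto
  obtain y where y: "y \<in> expanded_edge r e0" "g y = x" using ex[OF e0] by auto
  have all: "y \<in> expanded_edge r e" if e: "e \<in> T" for e
  proof -
    obtain z where "z \<in> expanded_edge r e" "g z = x" using ex[OF e] by auto
    moreover have "z = y" using g(1) calculation y e e0
      by (intro inj_onD[OF g(1)]) (auto simp: expansion_eq)
    ultimately show ?thesis by simp
  qed
  show False
  proof (cases y)
    case (Inl a)
    then have "a \<in> \<Inter>T" using all by (auto simp: expanded_edge_def)
    then show False using assms by simp
  next
    \<comment> \<open>A new vertex determines its edge, so \<open>T\<close> would be a single edge,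
      equal to \<open>\<Inter>T\<close> and yet nonempty.\<close>
    case (Inr b)
    then have "e = fst b" if "e \<in> T" for e using all[OF that] by (auto simp: expanded_edge_def)
    then have "T = {e0}" using e0 by blast
    then have "e0 = {}" using assms(1) by simp
    then show False using assms(3,4) e0 by (auto simp: uniform_hypergraph_def)
  qed
qed

text \<open>The second edge of a tight tree shares \<open>k - 1\<close> vertices with the first. A
  copy would map these two edges to distinct edges of \<open>F\<close> with an intersection that is
  too large.\<close>

lemma packing_no_expansion:
  assumes "\<Inter>T = {}" "tight_tree k T" "2 \<le> k"
    and pack: "\<And>e f. e \<in> F \<Longrightarrow> f \<in> F \<Longrightarrow> e \<noteq> f \<Longrightarrow> card (e \<inter> f) < k - 1"
    and "uniform_hypergraph r F"
  shows "\<not> contains_copy F (expansion r T)"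
proof
  assume "contains_copy F (expansion r T)"
  then obtain g where g: "inj_on g (\<Union>(expansion r T))" "\<And>e. e \<in> T \<Longrightarrow> g ` expanded_edge r e \<in> F"
    by (auto simp: contains_copy_def expansion_eq)
  from assms(2) obtain es where es: "es \<noteq> []" "distinct es" "set es = T" and
    step: "\<And>i. 1 \<le> i \<Longrightarrow> i < length es \<Longrightarrow>
           \<exists>v\<in>es ! i. \<exists>s<i. v \<notin> (\<Union>j<i. es ! j) \<and> es ! i - {v} \<subseteq> es ! s"
    and unif: "uniform_hypergraph k T"
    unfolding tight_tree_def by metis
  \<comment> \<open>A tree with one edge would have that nonempty edge as
    \<open>\<Inter>T\<close>.\<close>
  have len: "1 < length es"
  proof (rule ccontr)
    assume "\<not> ?thesis"
    then obtain e where "es = [e]" using es(1) by (cases es) auto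
    then have "T = {e}" using es by auto
    then show False using assms(1,3) unif by (auto simp: uniform_hypergraph_def)
  qed
  define e0 e1 where "e0 = es ! 0" and "e1 = es ! 1"
  have e: "e0 \<in> T" "e1 \<in> T" "e0 \<noteq> e1"
    using len es by (auto simp: e0_def e1_def nth_eq_iff_index_eq)
  \<comment> \<open>For \<open>i = 1\<close> the only possible predecessor is
    \<open>es ! 0\<close>.\<close>
  obtain v where v: "v \<in> e1" "e1 - {v} \<subseteq> e0" using step[of 1] len by (auto simp: e0_def e1_def)
  let ?A = "Inl ` (e1 - {v}) :: ('a + 'a set \<times> nat) set"
  have A: "?A \<subseteq> expanded_edge r e0" "?A \<subseteq> expanded_edge r e1"
    using v by (auto simp: expanded_edge_def)
  have sub: "expanded_edge r e0 \<subseteq> \<Union>(expansion r T)" "expanded_edge r e1 \<subseteq> \<Union>(expansion r T)"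
    using e by (auto simp: expansion_eq)
  have ne: "g ` expanded_edge r e0 \<noteq> g ` expanded_edge r e1"
    using inj_on_image_eq_iff[OF g(1) sub] inj_expanded_edge e(3) by (auto dest: injD)
  have fin: "finite (g ` expanded_edge r e0)"
    using e unif by (auto simp: uniform_hypergraph_def finite_expanded_edge)
  have "k - 1 = card (g ` ?A)"
  proof -
    have "inj_on g ?A" using g(1) A sub by (meson inj_on_subset)
    moreover have "card ?A = k - 1" using e v unif by (simp add: card_image uniform_hypergraph_def)
    ultimately show ?thesis by (simp add: card_image)
  qed
  also have "\<dots> \<le> card (g ` expanded_edge r e0 \<inter> g ` expanded_edge r e1)"
    using A fin by (intro card_mono) auto
  finally show False using pack[OF g(2)[OF e(1)] g(2)[OF e(2)] ne] by simp
qed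

text \<open>Take \<open>F\<close> maximal with the intersection property. By maximality every edge
  of \<open>G\<close> contains a j-subset of some edge of \<open>F\<close>. An edge of
  \<open>F\<close> has \<open>r choose j\<close> such subsets, each in at most \<open>D\<close>
  edges of \<open>G\<close>.\<close>

lemma large_packing:
  assumes "finite G" "uniform_hypergraph r G"
    and deg: "\<And>\<sigma>. card \<sigma> = j \<Longrightarrow> codegree G \<sigma> \<le> D"
    and "j \<le> r"
  shows "\<exists>F\<subseteq>G. (\<forall>e\<in>F. \<forall>f\<in>F. e \<noteq> f \<longrightarrow> card (e \<inter> f) < j) \<and>
           card G \<le> card F * ((r choose j) * D)"
proof -
  define P where "P = (\<lambda>F. F \<subseteq> G \<and> (\<forall>e\<in>F. \<forall>f\<in>F. e \<noteq> f \<longrightarrow> card (e \<inter> f) < j))"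
  have "finite {F. P F}" by (rule finite_subset[of _ "Pow G"]) (use assms in \<open>auto simp: P_def\<close>)
  moreover have "P {}" by (simp add: P_def)
  ultimately obtain F where F: "P F" and max: "\<And>F'. P F' \<Longrightarrow> F \<subseteq> F' \<Longrightarrow> F = F'"
    using finite_has_maximal[of "{F. P F}"] by blast
  have FG: "F \<subseteq> G" "finite F" using F assms(1) finite_subset by (auto simp: P_def)
  have u: "finite e" "card e = r" if "e \<in> G" for e using that assms by (auto simp: uniform_hypergraph_def)
  have cov: "\<exists>f\<in>F. card (e \<inter> f) \<ge> j" if e: "e \<in> G" for e
  proof (rule ccontr)
    assume neg: "\<not> ?thesis"
    \<comment> \<open>An edge of \<open>F\<close> meets itself in \<open>r\<close> vertices, which
      is at least \<open>j\<close>, so an uncovered edge lies outside \<open>F\<close> and could be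
      added.\<close>
    then have "e \<notin> F" using u[OF e] assms(4) by force
    moreover have "P (insert e F)"
      using F e neg unfolding P_def by (auto simp: not_le Int_commute)
    ultimately show False using max[of "insert e F"] by auto
  qed
  have "G \<subseteq> (\<Union>f\<in>F. \<Union>\<sigma>\<in>{\<sigma>. \<sigma> \<subseteq> f \<and> card \<sigma> = j}. {e\<in>G. \<sigma> \<subseteq> e})"
  proof
    fix e assume e: "e \<in> G"
    then obtain f where f: "f \<in> F" "card (e \<inter> f) \<ge> j" using cov by auto
    then obtain \<sigma> where "\<sigma> \<subseteq> e \<inter> f" "card \<sigma> = j"
      by (meson obtain_subset_with_card_n)
    then show "e \<in> (\<Union>f\<in>F. \<Union>\<sigma>\<in>{\<sigma>. \<sigma> \<subseteq> f \<and> card \<sigma> = j}. {e\<in>G. \<sigma> \<subseteq> e})"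
      using e f by auto
  qed
  then have "card G \<le> card (\<Union>f\<in>F. \<Union>\<sigma>\<in>{\<sigma>. \<sigma> \<subseteq> f \<and> card \<sigma> = j}. {e\<in>G. \<sigma> \<subseteq> e})"
    using assms(1) by (intro card_mono) (auto intro: finite_subset[of _ G])
  also have "\<dots> \<le> (\<Sum>f\<in>F. card (\<Union>\<sigma>\<in>{\<sigma>. \<sigma> \<subseteq> f \<and> card \<sigma> = j}. {e\<in>G. \<sigma> \<subseteq> e}))"
    using FG by (intro card_UN_le)
  also have "\<dots> \<le> (\<Sum>f\<in>F. (r choose j) * D)"
  proof (rule sum_mono)
    fix f assume "f \<in> F"
    then have f: "finite f" "card f = r" using u FG by auto
    have fs: "finite {\<sigma>. \<sigma> \<subseteq> f \<and> card \<sigma> = j}" using f by auto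
    have "card (\<Union>\<sigma>\<in>{\<sigma>. \<sigma> \<subseteq> f \<and> card \<sigma> = j}. {e\<in>G. \<sigma> \<subseteq> e})
        \<le> (\<Sum>\<sigma>\<in>{\<sigma>. \<sigma> \<subseteq> f \<and> card \<sigma> = j}. card {e\<in>G. \<sigma> \<subseteq> e})"
      using fs by (rule card_UN_le)
    also have "\<dots> \<le> (\<Sum>\<sigma>\<in>{\<sigma>. \<sigma> \<subseteq> f \<and> card \<sigma> = j}. D)"
      using deg by (intro sum_mono) (auto simp: codegree_def)
    also have "\<dots> = (r choose j) * D" using n_subsets[OF f(1), of j] f(2) by simp
    finally show "card (\<Union>\<sigma>\<in>{\<sigma>. \<sigma> \<subseteq> f \<and> card \<sigma> = j}. {e\<in>G. \<sigma> \<subseteq> e}) \<le> (r choose j) * D" .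
  qed
  also have "\<dots> = card F * ((r choose j) * D)" by simp
  finally have "card G \<le> card F * ((r choose j) * D)" .
  with F show ?thesis unfolding P_def by (intro exI[of _ F]) simp
qed

section \<open>The extremal number as a maximum\<close>

lemma finite_free_cards:
  assumes "finite G"
  shows "finite {card F | F. F \<subseteq> G \<and> \<not> contains_copy F H}"
  by (rule finite_subset[of _ "card ` Pow G"]) (use assms in auto)

lemma ex_number_ge:
  assumes "finite G" "F \<subseteq> G" "\<not> contains_copy F H"
  shows "card F \<le> ex_number G H"
  unfolding ex_number_def using assms finite_free_cards[OF assms(1)] by (intro Max_ge) auto

lemma ex_number_le:
  assumes "finite G" "H \<noteq> {}" "\<And>F. F \<subseteq> G \<Longrightarrow> \<not> contains_copy F H \<Longrightarrow> card F \<le> m"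
  shows "ex_number G H \<le> m"
  unfolding ex_number_def
proof (rule Max.boundedI[OF finite_free_cards[OF assms(1)]])
  \<comment> \<open>The empty family is always admissible, so the maximum is over a nonempty
    set.\<close>
  have "\<not> contains_copy ({} :: 'a set set) H" using assms(2) by (auto simp: contains_copy_def)
  then show "{card F | F. F \<subseteq> G \<and> \<not> contains_copy F H} \<noteq> {}" by blast
qed (use assms(3) in auto)

section \<open>Random hypergraphs\<close>

lemma finite_complete_hypergraph: "finite (complete_hypergraph r n)"
  by (rule finite_subset[of _ "Pow {..<n}"]) (auto simp: complete_hypergraph_def)

lemma uniform_complete_hypergraph: "uniform_hypergraph r (complete_hypergraph r n)"
  by (auto simp: complete_hypergraph_def uniform_hypergraph_def intro: finite_subset[of _ "{..<n}"])

lemma card_complete_hypergraph: "card (complete_hypergraph r n) = n choose r"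
  unfolding complete_hypergraph_def using n_subsets[of "{..<n}" r] by simp

lemma binomial_le_power: "n choose j \<le> n ^ j"
  by (cases "j \<le> n") (auto intro: binomial_le_pow simp: binomial_eq_0)

lemma finite_set_random_hypergraph: "finite (set_pmf (random_hypergraph r n p))"
  by (rule finite_subset[of _ "Pow (complete_hypergraph r n)"])
     (auto simp: random_hypergraph_def finite_complete_hypergraph)

lemma random_hypergraph_subset:
  "G \<in> set_pmf (random_hypergraph r n p) \<Longrightarrow> G \<subseteq> complete_hypergraph r n"
  by (auto simp: random_hypergraph_def)

section \<open>Exponential moments and tail bounds\<close>

text \<open>The power factors over the independent potential edges: one outside \<open>S\<close>
  contributes 1, one in \<open>S\<close> contributes \<open>1 - p + p * a\<close> in expectation.
  The values \<open>a = 2\<close> and \<open>a = 1/2\<close> give the two tail bounds.\<close>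

lemma expectation_power_card_random:
  fixes p a :: real
  assumes "0 \<le> p" "p \<le> 1" "0 \<le> a" and S: "S \<subseteq> complete_hypergraph r n"
  shows "measure_pmf.expectation (random_hypergraph r n p) (\<lambda>G. a ^ card (G \<inter> S))
       = (1 - p + p * a) ^ card S"
proof -
  let ?K = "complete_hypergraph r n"
  define f :: "nat set \<Rightarrow> bool \<Rightarrow> real" where "f = (\<lambda>e b. if e \<in> S \<and> b then a else 1)"
  have "a ^ card ({e \<in> ?K. \<omega> e} \<inter> S) = (\<Prod>e\<in>?K. f e (\<omega> e))" for \<omega>
  proof -
    have "(\<Prod>e\<in>?K. f e (\<omega> e)) = (\<Prod>e\<in>{e\<in>?K. e \<in> S \<and> \<omega> e}. a)"
      unfolding f_def by (rule prod.inter_filter[symmetric, OF finite_complete_hypergraph])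
    also have "{e\<in>?K. e \<in> S \<and> \<omega> e} = {e \<in> ?K. \<omega> e} \<inter> S" by auto
    finally show ?thesis by simp
  qed
  then have "measure_pmf.expectation (random_hypergraph r n p) (\<lambda>G. a ^ card (G \<inter> S))
      = measure_pmf.expectation (Pi_pmf ?K False (\<lambda>_. bernoulli_pmf p)) (\<lambda>\<omega>. \<Prod>e\<in>?K. f e (\<omega> e))"
    unfolding random_hypergraph_def by simp
  also have "\<dots> = (\<Prod>e\<in>?K. measure_pmf.expectation (bernoulli_pmf p) (f e))"
    using finite_complete_hypergraph assms(3)
    by (intro expectation_prod_Pi_pmf) (auto simp: f_def integrable_measure_pmf_finite)
  also have "\<dots> = (\<Prod>e\<in>?K. if e \<in> S then 1 - p + p * a else 1)"
    using assms by (intro prod.cong) (auto simp: f_def)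
  also have "\<dots> = (\<Prod>e\<in>{e\<in>?K. e \<in> S}. 1 - p + p * a)"
    by (rule prod.inter_filter[symmetric, OF finite_complete_hypergraph])
  also have "{e\<in>?K. e \<in> S} = S" using S by auto
  finally show ?thesis by simp
qed

lemma markov_pmf:
  fixes u :: "'a \<Rightarrow> real"
  assumes "finite (set_pmf M)" "\<And>x. 0 \<le> u x" "0 < c"
  shows "measure_pmf.prob M {x. c \<le> u x} \<le> measure_pmf.expectation M u / c"
  using integral_Markov_inequality_measure[of "measure_pmf M" u "{}" c] assms
  by (simp add: integrable_measure_pmf_finite)

text \<open>Markov's inequality for 2 to the power \<open>card (G \<inter> S)\<close>: the
  expectation is at most \<open>exp (p * card S)\<close>, hence at most \<open>exp M\<close>, and
  division by \<open>2 powr (4 * M)\<close> gains at least \<open>exp (2 * M)\<close>. Here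
  \<open>M\<close> is any bound on the mean, so it can be raised until a union bound
  succeeds.\<close>

lemma upper_tail:
  fixes p M :: real
  assumes p: "0 \<le> p" "p \<le> 1" and S: "S \<subseteq> complete_hypergraph r n" and M: "p * card S \<le> M"
  shows "measure_pmf.prob (random_hypergraph r n p) {G. 4 * M < card (G \<inter> S)} \<le> exp (- M)"
proof -
  let ?R = "random_hypergraph r n p"
  have M0: "0 \<le> M" using p M by (meson mult_nonneg_nonneg of_nat_0_le_iff order_trans)
  have "measure_pmf.prob ?R {G. 4 * M < card (G \<inter> S)}
      \<le> measure_pmf.prob ?R {G. 2 powr (4 * M) \<le> (2::real) ^ card (G \<inter> S)}"
    by (intro measure_pmf.finite_measure_mono) (auto simp: powr_realpow[symmetric])
  also have "\<dots> \<le> measure_pmf.expectation ?R (\<lambda>G. 2 ^ card (G \<inter> S)) / 2 powr (4 * M)"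
    by (intro markov_pmf finite_set_random_hypergraph) auto
  also have "\<dots> = (1 + p) ^ card S / 2 powr (4 * M)"
    using expectation_power_card_random[OF p _ S, of 2] by (simp add: algebra_simps)
  also have "\<dots> \<le> exp p ^ card S / 2 powr (4 * M)"
    using p by (intro divide_right_mono power_mono exp_ge_add_one_self) auto
  also have "\<dots> = exp (p * card S - 4 * M * ln 2)"
    by (simp add: exp_of_nat2_mult[symmetric] powr_def exp_diff mult.commute)
  also have "\<dots> \<le> exp (- M)"
  proof -
    have "M * 2 \<le> 4 * M * ln 2"
      using mult_left_mono[OF ln2_ge_two_thirds, of "4 * M"] M0 by simp
    then show ?thesis using M by simp
  qed
  finally show ?thesis .
qed

text \<open>Markov's inequality with base 1/2. With \<open>x = p * card S / 4\<close> the
  expectation is at most \<open>exp (- 2 * x)\<close>, and dividing by \<open>2 powr (- x)\<close>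
  costs at most a factor \<open>exp x\<close>.\<close>

lemma lower_tail:
  fixes p :: real
  assumes p: "0 \<le> p" "p \<le> 1" and S: "S \<subseteq> complete_hypergraph r n"
  shows "measure_pmf.prob (random_hypergraph r n p) {G. card (G \<inter> S) < p * card S / 4}
       \<le> exp (- p * card S / 4)"
proof -
  let ?R = "random_hypergraph r n p" and ?x = "p * card S / 4"
  have "measure_pmf.prob ?R {G. card (G \<inter> S) < ?x}
      \<le> measure_pmf.prob ?R {G. 2 powr (- ?x) \<le> (1/2::real) ^ card (G \<inter> S)}"
  proof (intro measure_pmf.finite_measure_mono subsetI CollectI; clarify?)
    fix G assume "card (G \<inter> S) < ?x"
    then have "2 powr (- ?x) \<le> 2 powr (- real (card (G \<inter> S)))" by simp
    also have "\<dots> = (1/2) ^ card (G \<inter> S)"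
      by (simp add: powr_minus powr_realpow power_one_over inverse_eq_divide)
    finally show "2 powr (- ?x) \<le> (1/2::real) ^ card (G \<inter> S)" .
  qed simp
  also have "\<dots> \<le> measure_pmf.expectation ?R (\<lambda>G. (1/2) ^ card (G \<inter> S)) / 2 powr (- ?x)"
    by (intro markov_pmf finite_set_random_hypergraph) auto
  also have "\<dots> = (1 + (- p / 2)) ^ card S / 2 powr (- ?x)"
    using expectation_power_card_random[OF p _ S, of "1/2"] by (simp add: algebra_simps)
  also have "\<dots> \<le> exp (- p / 2) ^ card S / 2 powr (- ?x)"
    using p by (intro divide_right_mono power_mono exp_ge_add_one_self) auto
  also have "\<dots> = exp (- 2 * ?x) / exp (- ?x * ln 2)"
    using exp_of_nat2_mult[of "- p / 2" "card S"] by (simp add: powr_def)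
  also have "\<dots> = exp (- 2 * ?x + ?x * ln 2)"
    by (simp add: exp_diff[symmetric])
  also have "\<dots> \<le> exp (- ?x)"
    using mult_left_mono[of "ln 2" 1 ?x] ln_2_less_1 p by simp
  finally show ?thesis by simp
qed

section \<open>Codegrees of the random hypergraph\<close>

text \<open>A union bound over at most \<open>n ^ j\<close> sets. Each lies in at most
  \<open>n ^ (r - j)\<close> potential edges, so \<open>M\<close> bounds each expected
  codegree.\<close>

lemma prob_large_codegree:
  fixes p M :: real
  assumes p: "0 \<le> p" "p \<le> 1" and j: "j \<le> r" and M: "p * real n ^ (r - j) \<le> M"
  shows "measure_pmf.prob (random_hypergraph r n p)
     {G. \<exists>\<sigma>\<subseteq>{..<n}. card \<sigma> = j \<and> 4 * M < card (G \<inter> {e \<in> complete_hypergraph r n. \<sigma> \<subseteq> e})}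
     \<le> real n ^ j * exp (- M)"
proof -
  let ?R = "random_hypergraph r n p" and ?I = "{\<sigma>. \<sigma> \<subseteq> {..<n} \<and> card \<sigma> = j}"
  let ?S = "\<lambda>\<sigma>. {e \<in> complete_hypergraph r n. \<sigma> \<subseteq> e}"
  let ?B = "\<lambda>\<sigma>. {G. 4 * M < card (G \<inter> ?S \<sigma>)}"
  have finI: "finite ?I" by (rule finite_subset[of _ "Pow {..<n}"]) auto
  have cS: "card (?S \<sigma>) \<le> n ^ (r - j)" if "\<sigma> \<in> ?I" for \<sigma>
  proof -
    have fs: "finite \<sigma>" using that finite_subset by auto
    have "card (?S \<sigma>) \<le> card {A. A \<subseteq> {..<n} \<and> card A = r - j}"
    \<comment> \<open>An edge containing \<open>\<sigma>\<close> is determined by its remaining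
      \<open>r - j\<close> vertices.\<close>
    proof (rule card_inj_on_le[where f = "\<lambda>e. e - \<sigma>"])
      show "inj_on (\<lambda>e. e - \<sigma>) (?S \<sigma>)" by (auto simp: inj_on_def)
      show "(\<lambda>e. e - \<sigma>) ` ?S \<sigma> \<subseteq> {A. A \<subseteq> {..<n} \<and> card A = r - j}"
        using that fs by (auto simp: complete_hypergraph_def card_Diff_subset)
      show "finite {A. A \<subseteq> {..<n} \<and> card A = r - j}"
        by (rule finite_subset[of _ "Pow {..<n}"]) auto
    qed
    also have "\<dots> = n choose (r - j)" using n_subsets[of "{..<n}" "r - j"] by simp
    finally show ?thesis using binomial_le_power le_trans by blast
  qed
  have each: "measure_pmf.prob ?R (?B \<sigma>) \<le> exp (- M)" if "\<sigma> \<in> ?I" for \<sigma>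
  proof (rule upper_tail[OF p])
    have "real (card (?S \<sigma>)) \<le> real n ^ (r - j)"
      using cS[OF that] by (metis of_nat_le_iff of_nat_power)
    then show "p * real (card (?S \<sigma>)) \<le> M"
      using M p(1) by (meson mult_left_mono order_trans)
  qed auto
  have "measure_pmf.prob ?R {G. \<exists>\<sigma>\<subseteq>{..<n}. card \<sigma> = j \<and> 4 * M < card (G \<inter> ?S \<sigma>)}
      = measure_pmf.prob ?R (\<Union>\<sigma>\<in>?I. ?B \<sigma>)"
    by (rule arg_cong[of _ _ "measure_pmf.prob ?R"]) auto
  also have "\<dots> \<le> (\<Sum>\<sigma>\<in>?I. measure_pmf.prob ?R (?B \<sigma>))"
    using finI by (intro measure_pmf.finite_measure_subadditive_finite) auto
  also have "\<dots> \<le> (\<Sum>\<sigma>\<in>?I. exp (- M))" by (intro sum_mono each)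
  also have "\<dots> = real (n choose j) * exp (- M)" using n_subsets[of "{..<n}" j] by simp
  also have "\<dots> \<le> real n ^ j * exp (- M)"
    using binomial_le_power[of n j] by (intro mult_right_mono) (metis of_nat_le_iff of_nat_power, simp)
  finally show ?thesis .
qed

text \<open>Sets that leave the vertex set \<open>{..<n}\<close> have codegree 0, so the union bound
  over subsets of \<open>{..<n}\<close> controls all codegrees.\<close>

lemma codegree_le_if_not_large:
  fixes M :: real
  assumes G: "G \<subseteq> complete_hypergraph r n" and M: "0 \<le> M"
    and small: "\<not> (\<exists>\<sigma>\<subseteq>{..<n}. card \<sigma> = j \<and> 4 * M < card (G \<inter> {e \<in> complete_hypergraph r n. \<sigma> \<subseteq> e}))"
    and "card \<sigma> = j"
  shows "codegree G \<sigma> \<le> 4 * M"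
proof (cases "\<sigma> \<subseteq> {..<n}")
  case True
  have "{e \<in> G. \<sigma> \<subseteq> e} = G \<inter> {e \<in> complete_hypergraph r n. \<sigma> \<subseteq> e}" using G by auto
  then show ?thesis using small True assms(4) unfolding codegree_def by (metis not_le)
next
  case False
  then have "{e \<in> G. \<sigma> \<subseteq> e} = {}" using G by (auto simp: complete_hypergraph_def)
  then show ?thesis using M by (simp only: codegree_def) simp
qed

text \<open>Separates a deterministic argument outside a bad event \<open>B n\<close> from a bound
  on its probability. Only points of the support matter, so \<open>G\<close> may be taken inside the
  complete hypergraph.\<close>

lemma asymptotically_almost_surelyI:
  assumes good: "\<forall>\<^sub>F n in sequentially. \<forall>G\<in>set_pmf (M n). G \<notin> B n \<longrightarrow> P n G"
    and bad: "\<forall>\<^sub>F n in sequentially. measure_pmf.prob (M n) (B n) \<le> b n"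
    and "b \<longlonglongrightarrow> 0"
  shows "asymptotically_almost_surely M P"
  unfolding asymptotically_almost_surely_def
proof (rule tendsto_sandwich)
  show "(\<lambda>n. 1 - b n) \<longlonglongrightarrow> 1" using tendsto_diff[OF tendsto_const assms(3), of 1] by simp
  show "(\<lambda>_. 1) \<longlonglongrightarrow> (1::real)" by simp
  show "\<forall>\<^sub>F n in sequentially. measure_pmf.prob (M n) {x. P n x} \<le> 1" by simp
  show "\<forall>\<^sub>F n in sequentially. 1 - b n \<le> measure_pmf.prob (M n) {x. P n x}"
    using good bad
  proof eventually_elim
    case (elim n)
    have "1 - b n \<le> 1 - measure_pmf.prob (M n) (B n)" using elim by simp
    also have "\<dots> = measure_pmf.prob (M n) (- B n)"
      using measure_pmf.prob_compl[of "B n" "M n"] by (simp add: Compl_eq_Diff_UNIV)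
    also have "\<dots> = measure_pmf.prob (M n) (- B n \<inter> set_pmf (M n))"
      by (simp add: measure_Int_set_pmf)
    also have "\<dots> \<le> measure_pmf.prob (M n) {x. P n x}"
      using elim(1) by (intro measure_pmf.finite_measure_mono) auto
    finally show ?case .
  qed
qed

section \<open>Deterministic bounds on the extremal number\<close>

text \<open>Combines \<open>card_le_if_no_expanded_tree\<close> with the fact that there are at most
  \<open>n ^ (k - 1)\<close> shadow sets.\<close>

lemma ex_number_upper:
  fixes T :: "'a set set" and D :: real
  assumes "2 \<le> k" "k \<le> r" "tight_tree k T" and G: "G \<subseteq> complete_hypergraph r n"
    and deg: "\<And>\<sigma>. card \<sigma> = k \<Longrightarrow> codegree G \<sigma> \<le> D" and "0 \<le> D"
  shows "real (ex_number G (expansion r T)) \<le> card (\<Union>(expansion r T)) * D * real n ^ (k - 1)"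
proof -
  define m where "m = card (\<Union>(expansion r T))"
  \<comment> \<open>Codegrees are integers, so a real bound may be rounded down.\<close>
  define d where "d = nat \<lfloor>D\<rfloor>"
  have finG: "finite G" using G finite_complete_hypergraph finite_subset by blast
  have "T \<noteq> {}" using assms(3) by (auto simp: tight_tree_def)
  have "ex_number G (expansion r T) \<le> m * d * n ^ (k - 1)"
  proof (rule ex_number_le[OF finG])
    show "expansion r T \<noteq> {}" using \<open>T \<noteq> {}\<close> by (simp add: expansion_eq)
  next
    fix F assume F: "F \<subseteq> G" "\<not> contains_copy F (expansion r T)"
    have FK: "F \<subseteq> complete_hypergraph r n" using F G by simp
    have "codegree F \<sigma> \<le> d" if "card \<sigma> = k" for \<sigma>
    proof -
      have "codegree F \<sigma> \<le> codegree G \<sigma>"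
        unfolding codegree_def using F finG by (intro card_mono) auto
      then show ?thesis using deg[OF that] \<open>0 \<le> D\<close> by (simp add: d_def le_nat_floor)
    qed
    then have "card F \<le> m * d * card (shadow (k - 1) F)"
      unfolding m_def using F finite_subset[OF F(1) finG]
      by (intro card_le_if_no_expanded_tree assms uniform_hypergraph_subset[OF FK] uniform_complete_hypergraph)
    also have "card (shadow (k - 1) F) \<le> card {A. A \<subseteq> {..<n} \<and> card A = k - 1}"
    proof (rule card_mono)
      show "finite {A. A \<subseteq> {..<n} \<and> card A = k - 1}"
        by (rule finite_subset[of _ "Pow {..<n}"]) auto
      show "shadow (k - 1) F \<subseteq> {A. A \<subseteq> {..<n} \<and> card A = k - 1}"
        using FK by (auto simp: shadow_def complete_hypergraph_def)
    qed
    also have "\<dots> = n choose (k - 1)" using n_subsets[of "{..<n}" "k - 1"] by simp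
    also have "\<dots> \<le> n ^ (k - 1)" by (rule binomial_le_power)
    finally show "card F \<le> m * d * n ^ (k - 1)" by simp
  qed
  then have "real (ex_number G (expansion r T)) \<le> real m * real d * real n ^ (k - 1)"
    by (metis of_nat_le_iff of_nat_mult of_nat_power)
  also have "\<dots> \<le> real m * D * real n ^ (k - 1)"
    using \<open>0 \<le> D\<close> by (intro mult_right_mono mult_left_mono) (auto simp: d_def)
  finally show ?thesis by (simp add: m_def)
qed

lemma ex_number_star:
  assumes "2 \<le> k" "tight_tree k T" "\<Inter>T = {}" and G: "G \<subseteq> complete_hypergraph r n"
  shows "card (G \<inter> {e \<in> complete_hypergraph r n. x \<in> e}) \<le> ex_number G (expansion r T)"
proof (rule ex_number_ge)
  show "finite G" using G finite_complete_hypergraph finite_subset by blast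
  show "\<not> contains_copy (G \<inter> {e \<in> complete_hypergraph r n. x \<in> e}) (expansion r T)"
    using assms by (intro star_no_expansion[where k = k and x = x]) (auto simp: tight_tree_def)
qed simp

text \<open>The packing with \<open>j = k - 1\<close> is an admissible subfamily. The inequality is
  left in product form, so that a degree bound of the order of the mean later cancels against
  \<open>card G\<close>.\<close>

lemma ex_number_packing:
  fixes T :: "'a set set" and D :: real
  assumes "2 \<le> k" "k \<le> r" "tight_tree k T" "\<Inter>T = {}" and G: "G \<subseteq> complete_hypergraph r n"
    and deg: "\<And>\<sigma>. card \<sigma> = k - 1 \<Longrightarrow> codegree G \<sigma> \<le> D" and "0 \<le> D"
  shows "real (card G) \<le> real (ex_number G (expansion r T)) * (real (r choose (k - 1)) * D)"
proof -
  define d where "d = nat \<lfloor>D\<rfloor>"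
  have finG: "finite G" using G finite_complete_hypergraph finite_subset by blast
  have u: "uniform_hypergraph r G"
    using G uniform_complete_hypergraph uniform_hypergraph_subset by blast
  have d: "codegree G \<sigma> \<le> d" if "card \<sigma> = k - 1" for \<sigma>
    using deg[OF that] \<open>0 \<le> D\<close> by (simp add: d_def le_nat_floor)
  have "k - 1 \<le> r" using assms(2) by simp
  from large_packing[OF finG u _ this, of d] d obtain F where F: "F \<subseteq> G" "\<forall>e\<in>F. \<forall>f\<in>F. e \<noteq> f \<longrightarrow> card (e \<inter> f) < k - 1"
      "card G \<le> card F * ((r choose (k - 1)) * d)"
    by metis
  have "\<not> contains_copy F (expansion r T)"
    using F(2) by (intro packing_no_expansion[OF assms(4,3,1) _ uniform_hypergraph_subset[OF F(1) u]]) auto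
  then have "card F \<le> ex_number G (expansion r T)" using ex_number_ge finG F(1) by blast
  then have "card G \<le> ex_number G (expansion r T) * ((r choose (k - 1)) * d)"
    using F(3) by (meson le_trans mult_le_mono1)
  then have "real (card G) \<le> real (ex_number G (expansion r T)) * (real (r choose (k - 1)) * real d)"
    by (metis of_nat_le_iff of_nat_mult)
  also have "\<dots> \<le> real (ex_number G (expansion r T)) * (real (r choose (k - 1)) * D)"
    using \<open>0 \<le> D\<close> by (intro mult_left_mono) (auto simp: d_def)
  finally show ?thesis .
qed

text \<open>Adding 0 embeds the (r-1)-subsets of \<open>{1..<n}\<close> into the star. The base
  comes from \<open>n - 1 \<ge> n / 2\<close> and \<open>r - 1 \<le> r\<close>.\<close>

lemma card_star_ge:
  assumes "2 \<le> r" "2 * r \<le> n"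
  shows "(real n / (2 * real r)) ^ (r - 1) \<le> card {e \<in> complete_hypergraph r n. 0 \<in> e}"
proof -
  have "(real n / (2 * real r)) ^ (r - 1) \<le> (real (n - 1) / real (r - 1)) ^ (r - 1)"
  proof (intro power_mono)
    have "real n / (2 * real r) = (real n / 2) / real r" by simp
    also have "\<dots> \<le> real (n - 1) / real (r - 1)" using assms by (intro frac_le) auto
    finally show "real n / (2 * real r) \<le> real (n - 1) / real (r - 1)" .
  qed simp
  also have "\<dots> \<le> real ((n - 1) choose (r - 1))"
    using assms by (intro binomial_ge_n_over_k_pow_k) auto
  also have "\<dots> = real (card {A. A \<subseteq> {1..<n} \<and> card A = r - 1})"
    using n_subsets[of "{1..<n}" "r - 1"] by simp
  also have "\<dots> \<le> real (card {e \<in> complete_hypergraph r n. 0 \<in> e})"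
  proof (rule of_nat_mono, rule card_inj_on_le[where f = "insert 0"])
    show "inj_on (insert 0) {A. A \<subseteq> {1..<n} \<and> card A = r - 1}"
    proof (rule inj_onI)
      fix A B assume "A \<in> {A. A \<subseteq> {1..<n} \<and> card A = r - 1}" "B \<in> {A. A \<subseteq> {1..<n} \<and> card A = r - 1}"
        and eq: "insert 0 A = insert 0 B"
      then have "0 \<notin> A" "0 \<notin> B" by auto
      with eq show "A = B" by (simp add: insert_ident)
    qed
    show "insert 0 ` {A. A \<subseteq> {1..<n} \<and> card A = r - 1} \<subseteq> {e \<in> complete_hypergraph r n. 0 \<in> e}"
    proof safe
      fix A assume A: "A \<subseteq> {1..<n}" "card A = r - 1"
      then have "finite A" "0 \<notin> A" using finite_subset by auto
      then show "insert 0 A \<in> complete_hypergraph r n"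
        using A assms by (auto simp: complete_hypergraph_def)
    qed
    show "finite {e \<in> complete_hypergraph r n. 0 \<in> e}" using finite_complete_hypergraph by simp
  qed
  finally show ?thesis .
qed

text \<open>Once \<open>ln n\<close> is at least \<open>k + 1\<close>, the exponent
  \<open>k * ln n - (ln n)^2\<close> is at most \<open>- ln n\<close>. This is why mean bounds of
  size at least log^2 n suffice for union bounds over polynomially many sets.\<close>

lemma power_times_exp_ln_square_tendsto_0:
  "(\<lambda>n. real n ^ k * exp (- (ln (real n))\<^sup>2)) \<longlonglongrightarrow> 0"
proof (rule Lim_null_comparison)
  show "(\<lambda>n. exp (- ln (real n))) \<longlonglongrightarrow> 0" by real_asymp
  have "\<forall>\<^sub>F n in sequentially. real k + 1 \<le> ln (real n)" by real_asymp
  then show "\<forall>\<^sub>F n in sequentially. norm (real n ^ k * exp (- (ln (real n))\<^sup>2)) \<le> exp (- ln (real n))"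
    using eventually_gt_at_top[of 0]
  proof eventually_elim
    case (elim n)
    have "real n ^ k = exp (real k * ln (real n))"
      using elim by (simp add: exp_of_nat_mult)
    then have "real n ^ k * exp (- (ln (real n))\<^sup>2) = exp (real k * ln (real n) - (ln (real n))\<^sup>2)"
      by (simp add: exp_diff exp_minus divide_inverse)
    moreover have "(real k + 1) * ln (real n) \<le> (ln (real n))\<^sup>2"
      unfolding power2_eq_square using elim by (intro mult_right_mono) auto
    ultimately show ?case by (simp add: algebra_simps)
  qed
qed

lemma exp_ln_square_tendsto_0:
  fixes a :: real
  assumes "0 < a"
  shows "(\<lambda>n. exp (- a * (ln (real n))\<^sup>2)) \<longlonglongrightarrow> 0"
  using assms by real_asymp

section \<open>The two ranges of the edge probability\<close>

text \<open>Since \<open>p n^(r-k)\<close> is at least log^2 n, all k-codegrees are at most 4 times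
  this value with high probability, which gives the upper bound. The star at 0 has mean size of
  order \<open>p n^(r-1)\<close> and gives the lower bound.\<close>

lemma ex_number_random_dense:
  fixes T :: "'a set set" and p :: "nat \<Rightarrow> real"
  assumes k: "2 \<le> k" "k \<le> r" and T: "tight_tree k T" "\<Inter>T = {}"
    and p: "\<And>n. 0 \<le> p n" "\<And>n. p n \<le> 1"
    and large: "\<forall>\<^sub>F n in sequentially. (ln (real n))\<^sup>2 \<le> p n * real n ^ (r - k)"
  shows "asymptotically_almost_surely (\<lambda>n. random_hypergraph r n (p n))
    (\<lambda>n G. 1 / (4 * (2 * real r) ^ (r - 1)) * p n * real n ^ (r - 1) \<le> real (ex_number G (expansion r T)) \<and>
           real (ex_number G (expansion r T)) \<le> 4 * real (card (\<Union>(expansion r T))) * p n * real n ^ (r - 1))"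
proof -
  \<comment> \<open>The 4 is lost in \<open>lower_tail\<close>, the power of \<open>2 * r\<close> in
    \<open>card_star_ge\<close>.\<close>
  define a where "a = 1 / (4 * (2 * real r) ^ (r - 1))"
  have a: "0 < a" using k by (simp add: a_def)
  define M where "M = (\<lambda>n. p n * real n ^ (r - k))"
  define S where "S = (\<lambda>n. {e \<in> complete_hypergraph r n. 0 \<in> e})"
  define B1 where "B1 = (\<lambda>n. {G. \<exists>\<sigma>\<subseteq>{..<n}. card \<sigma> = k \<and>
      4 * M n < card (G \<inter> {e \<in> complete_hypergraph r n. \<sigma> \<subseteq> e})})"
  define B2 where "B2 = (\<lambda>n. {G. real (card (G \<inter> S n)) < p n * card (S n) / 4})"
  have pow: "real n ^ (r - k) * real n ^ (k - 1) = real n ^ (r - 1)" for n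
    using k by (simp add: power_add[symmetric])
  have S: "a * p n * real n ^ (r - 1) \<le> p n * card (S n) / 4" if "2 * r \<le> n" for n
    using mult_left_mono[OF card_star_ge[of r n] p(1)[of n]] that k
    by (simp add: S_def a_def power_divide power_mult_distrib)
  show ?thesis
    unfolding a_def[symmetric]
  proof (rule asymptotically_almost_surelyI)
    show "\<forall>\<^sub>F n in sequentially. \<forall>G\<in>set_pmf (random_hypergraph r n (p n)). G \<notin> B1 n \<union> B2 n \<longrightarrow>
        a * p n * real n ^ (r - 1) \<le> real (ex_number G (expansion r T)) \<and>
        real (ex_number G (expansion r T)) \<le> 4 * real (card (\<Union>(expansion r T))) * p n * real n ^ (r - 1)"
      using eventually_ge_at_top[of "2 * r"]
    proof (eventually_elim, intro ballI impI conjI)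
      fix n G assume n: "2 * r \<le> n" and GR: "G \<in> set_pmf (random_hypergraph r n (p n))"
        and good: "G \<notin> B1 n \<union> B2 n"
      have G: "G \<subseteq> complete_hypergraph r n" using random_hypergraph_subset[OF GR] .
      have M: "0 \<le> M n" using p(1) by (simp add: M_def)
      have "a * p n * real n ^ (r - 1) \<le> p n * card (S n) / 4" by (rule S[OF n])
      also have "\<dots> \<le> real (card (G \<inter> S n))" using good by (simp add: B2_def)
      also have "\<dots> \<le> real (ex_number G (expansion r T))"
        unfolding S_def using ex_number_star[OF k(1) T G] by simp
      finally show "a * p n * real n ^ (r - 1) \<le> real (ex_number G (expansion r T))" .
      have "codegree G \<sigma> \<le> 4 * M n" if "card \<sigma> = k" for \<sigma>
        by (rule codegree_le_if_not_large[OF G M _ that]) (use good in \<open>simp add: B1_def\<close>)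
      then have "real (ex_number G (expansion r T))
          \<le> card (\<Union>(expansion r T)) * (4 * M n) * real n ^ (k - 1)"
        using M by (intro ex_number_upper[OF k T(1) G]) auto
      also have "\<dots> = 4 * real (card (\<Union>(expansion r T))) * p n * real n ^ (r - 1)"
        unfolding M_def pow[symmetric] by simp
      finally show "real (ex_number G (expansion r T))
          \<le> 4 * real (card (\<Union>(expansion r T))) * p n * real n ^ (r - 1)" .
    qed
    show "\<forall>\<^sub>F n in sequentially. measure_pmf.prob (random_hypergraph r n (p n)) (B1 n \<union> B2 n)
        \<le> real n ^ k * exp (- (ln (real n))\<^sup>2) + exp (- a * (ln (real n))\<^sup>2)"
      using large eventually_ge_at_top[of "2 * r"]
    proof eventually_elim
      case (elim n)
      let ?R = "random_hypergraph r n (p n)"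
      have n: "1 \<le> real n" using elim(2) k by simp
      have "measure_pmf.prob ?R (B1 n) \<le> real n ^ k * exp (- M n)"
        unfolding B1_def using p k by (intro prob_large_codegree) (auto simp: M_def)
      also have "\<dots> \<le> real n ^ k * exp (- (ln (real n))\<^sup>2)"
        using elim by (intro mult_left_mono) (auto simp: M_def)
      finally have 1: "measure_pmf.prob ?R (B1 n) \<le> real n ^ k * exp (- (ln (real n))\<^sup>2)" .
      have "measure_pmf.prob ?R (B2 n) \<le> exp (- p n * card (S n) / 4)"
        unfolding B2_def using p by (intro lower_tail) (auto simp: S_def)
      also have "\<dots> \<le> exp (- a * (ln (real n))\<^sup>2)"
      proof -
        have "(ln (real n))\<^sup>2 \<le> M n * 1" using elim by (simp add: M_def)
        also have "\<dots> \<le> M n * real n ^ (k - 1)"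
          using p n by (intro mult_left_mono one_le_power) (auto simp: M_def)
        also have "\<dots> = p n * real n ^ (r - 1)"
          unfolding M_def pow[symmetric] by simp
        finally have "a * (ln (real n))\<^sup>2 \<le> a * (p n * real n ^ (r - 1))"
          using a by (intro mult_left_mono) auto
        then show ?thesis using S[OF elim(2)] by simp
      qed
      finally have 2: "measure_pmf.prob ?R (B2 n) \<le> exp (- a * (ln (real n))\<^sup>2)" .
      have "measure_pmf.prob ?R (B1 n \<union> B2 n) \<le> measure_pmf.prob ?R (B1 n) + measure_pmf.prob ?R (B2 n)"
        by (rule measure_Un_le) auto
      with 1 2 show ?case by linarith
    qed
    show "(\<lambda>n. real n ^ k * exp (- (ln (real n))\<^sup>2) + exp (- a * (ln (real n))\<^sup>2)) \<longlonglongrightarrow> 0"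
      using tendsto_add[OF power_times_exp_ln_square_tendsto_0 exp_ln_square_tendsto_0[OF a]] by simp
  qed
qed

text \<open>The mean k-codegree is at most log^2 n, so all k-codegrees are at most 4 log^2 n, which
  gives the upper bound. For the lower bound the (k-1)-codegrees are at most \<open>4 * M\<close>
  while \<open>G\<close> has order \<open>M n^(k-1)\<close> edges or more, so \<open>M\<close>
  cancels in the packing bound. A spare factor log^2 n absorbs the constants on each side.\<close>

lemma ex_number_random_sparse:
  fixes T :: "'a set set" and p :: "nat \<Rightarrow> real"
  assumes k: "2 \<le> k" "k \<le> r" and T: "tight_tree k T" "\<Inter>T = {}"
    and p: "\<And>n. 0 \<le> p n" "\<And>n. p n \<le> 1"
    and large: "\<forall>\<^sub>F n in sequentially. (ln (real n))\<^sup>2 \<le> p n * real n ^ (r - (k - 1))"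
    and small: "\<forall>\<^sub>F n in sequentially. p n * real n ^ (r - k) \<le> (ln (real n))\<^sup>2"
  shows "asymptotically_almost_surely (\<lambda>n. random_hypergraph r n (p n))
    (\<lambda>n G. real n ^ (k - 1) / (ln (real n))\<^sup>2 \<le> real (ex_number G (expansion r T)) \<and>
           real (ex_number G (expansion r T)) \<le> real n ^ (k - 1) * ((ln (real n))\<^sup>2)\<^sup>2)"
proof -
  define L where "L = (\<lambda>n. (ln (real n))\<^sup>2)"
  \<comment> \<open>The 4 comes from \<open>lower_tail\<close>, the power of \<open>r\<close> from
    \<open>n choose r\<close> being at least \<open>(n / r)^r\<close>.\<close>
  define a where "a = 1 / (4 * real r ^ r)"
  have a: "0 < a" using k by (simp add: a_def)
  define b where "b = real (r choose (k - 1))"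
  have b: "0 < b" using k by (simp add: b_def)
  define M where "M = (\<lambda>n. p n * real n ^ (r - (k - 1)))"
  define K where "K = complete_hypergraph r"
  \<comment> \<open>Bad events: a k-set of large codegree, a (k-1)-set of large codegree, too few
    edges in total.\<close>
  define B1 where "B1 = (\<lambda>n. {G. \<exists>\<sigma>\<subseteq>{..<n}. card \<sigma> = k \<and>
      4 * L n < card (G \<inter> {e \<in> complete_hypergraph r n. \<sigma> \<subseteq> e})})"
  define B2 where "B2 = (\<lambda>n. {G. \<exists>\<sigma>\<subseteq>{..<n}. card \<sigma> = k - 1 \<and>
      4 * M n < card (G \<inter> {e \<in> complete_hypergraph r n. \<sigma> \<subseteq> e})})"
  define B3 where "B3 = (\<lambda>n. {G. real (card (G \<inter> K n)) < p n * card (K n) / 4})"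
  have K: "a * (M n * real n ^ (k - 1)) \<le> p n * card (K n) / 4" if "r \<le> n" for n
  proof -
    have "r - (k - 1) + (k - 1) = r" using k by simp
    then have pow: "real n ^ (r - (k - 1)) * real n ^ (k - 1) = real n ^ r"
      by (metis power_add)
    have "(real n / real r) ^ r \<le> real (n choose r)"
      using that by (rule binomial_ge_n_over_k_pow_k)
    from mult_left_mono[OF this p(1)[of n]] show ?thesis
      unfolding M_def mult.assoc pow
      by (simp add: K_def a_def power_divide card_complete_hypergraph)
  qed
  have Llarge: "\<forall>\<^sub>F n in sequentially. c \<le> L n" for c
    unfolding L_def by real_asymp
  have large': "\<forall>\<^sub>F n in sequentially. L n \<le> M n" using large by (simp add: L_def M_def)
  have small': "\<forall>\<^sub>F n in sequentially. p n * real n ^ (r - k) \<le> L n" using small by (simp add: L_def)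
  have "asymptotically_almost_surely (\<lambda>n. random_hypergraph r n (p n))
    (\<lambda>n G. real n ^ (k - 1) / L n \<le> real (ex_number G (expansion r T)) \<and>
           real (ex_number G (expansion r T)) \<le> real n ^ (k - 1) * (L n)\<^sup>2)"
  proof (rule asymptotically_almost_surelyI)
    show "\<forall>\<^sub>F n in sequentially. \<forall>G\<in>set_pmf (random_hypergraph r n (p n)). G \<notin> B1 n \<union> B2 n \<union> B3 n \<longrightarrow>
        real n ^ (k - 1) / L n \<le> real (ex_number G (expansion r T)) \<and>
        real (ex_number G (expansion r T)) \<le> real n ^ (k - 1) * (L n)\<^sup>2"
      using eventually_ge_at_top[of r] large'
        Llarge[of 1] Llarge[of "4 * real (card (\<Union>(expansion r T)))"] Llarge[of "4 * b / a"]
    proof (eventually_elim, intro ballI impI conjI)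
      fix n G assume n: "r \<le> n" and M: "L n \<le> M n" and L1: "1 \<le> L n"
        and Lm: "4 * real (card (\<Union>(expansion r T))) \<le> L n" and Lab: "4 * b / a \<le> L n"
        and GR: "G \<in> set_pmf (random_hypergraph r n (p n))"
        and good: "G \<notin> B1 n \<union> B2 n \<union> B3 n"
      let ?x = "real (ex_number G (expansion r T))"
      have G: "G \<subseteq> complete_hypergraph r n" using random_hypergraph_subset[OF GR] .
      have M0: "0 < M n" using M L1 by simp
      have "codegree G \<sigma> \<le> 4 * L n" if "card \<sigma> = k" for \<sigma>
        by (rule codegree_le_if_not_large[OF G _ _ that]) (use good L1 in \<open>auto simp: B1_def\<close>)
      then have "?x \<le> card (\<Union>(expansion r T)) * (4 * L n) * real n ^ (k - 1)"
        using L1 by (intro ex_number_upper[OF k T(1) G]) auto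
      also have "\<dots> = (4 * real (card (\<Union>(expansion r T)))) * (L n * real n ^ (k - 1))" by simp
      also have "\<dots> \<le> L n * (L n * real n ^ (k - 1))"
        using Lm L1 by (intro mult_right_mono) auto
      finally show "?x \<le> real n ^ (k - 1) * (L n)\<^sup>2" by (simp add: power2_eq_square mult_ac)
      have deg: "codegree G \<sigma> \<le> 4 * M n" if "card \<sigma> = k - 1" for \<sigma>
        by (rule codegree_le_if_not_large[OF G _ _ that]) (use good M0 in \<open>auto simp: B2_def\<close>)
      have "M n * (a * real n ^ (k - 1)) \<le> p n * card (K n) / 4" using K[OF n] by (simp add: mult_ac)
      also have "\<dots> \<le> real (card (G \<inter> K n))" using good by (simp add: B3_def)
      also have "G \<inter> K n = G" using G by (auto simp: K_def)
      also have "real (card G) \<le> ?x * (b * (4 * M n))"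
        unfolding b_def using M0 deg by (intro ex_number_packing[OF k T G]) auto
      finally have "M n * (a * real n ^ (k - 1)) \<le> M n * (?x * (4 * b))" by (simp add: mult_ac)
      \<comment> \<open>The unknown density disappears here, leaving a bound independent of
        \<open>p\<close>.\<close>
      then have "a * real n ^ (k - 1) \<le> ?x * (4 * b)" using M0 by simp
      then have "real n ^ (k - 1) \<le> ?x * (4 * b / a)" using a by (simp add: field_simps)
      also have "\<dots> \<le> ?x * L n" using Lab by (intro mult_left_mono) auto
      finally show "real n ^ (k - 1) / L n \<le> ?x" using L1 by (simp add: field_simps)
    qed
    show "\<forall>\<^sub>F n in sequentially. measure_pmf.prob (random_hypergraph r n (p n)) (B1 n \<union> B2 n \<union> B3 n)
        \<le> real n ^ k * exp (- L n) + real n ^ (k - 1) * exp (- L n) + exp (- a * L n)"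
      using large' small' eventually_ge_at_top[of r]
    proof eventually_elim
      case (elim n)
      let ?R = "random_hypergraph r n (p n)"
      have n: "1 \<le> real n" using elim(3) k by simp
      have 1: "measure_pmf.prob ?R (B1 n) \<le> real n ^ k * exp (- L n)"
        unfolding B1_def using p k elim by (intro prob_large_codegree) auto
      have "measure_pmf.prob ?R (B2 n) \<le> real n ^ (k - 1) * exp (- M n)"
        unfolding B2_def using p k by (intro prob_large_codegree) (auto simp: M_def)
      also have "\<dots> \<le> real n ^ (k - 1) * exp (- L n)"
        using elim by (intro mult_left_mono) auto
      finally have 2: "measure_pmf.prob ?R (B2 n) \<le> real n ^ (k - 1) * exp (- L n)" .
      have "measure_pmf.prob ?R (B3 n) \<le> exp (- p n * card (K n) / 4)"
        unfolding B3_def using p by (intro lower_tail) (auto simp: K_def)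
      also have "\<dots> \<le> exp (- a * L n)"
      proof -
        have "L n \<le> M n * 1" using elim by simp
        also have "\<dots> \<le> M n * real n ^ (k - 1)"
          using p n by (intro mult_left_mono one_le_power) (auto simp: M_def)
        finally have "a * L n \<le> a * (M n * real n ^ (k - 1))"
          using a by (intro mult_left_mono) auto
        then show ?thesis using K[OF elim(3)] by simp
      qed
      finally have 3: "measure_pmf.prob ?R (B3 n) \<le> exp (- a * L n)" .
      have "measure_pmf.prob ?R (B1 n \<union> B2 n \<union> B3 n)
          \<le> measure_pmf.prob ?R (B1 n \<union> B2 n) + measure_pmf.prob ?R (B3 n)"
        by (rule measure_Un_le) auto
      moreover have "measure_pmf.prob ?R (B1 n \<union> B2 n)
          \<le> measure_pmf.prob ?R (B1 n) + measure_pmf.prob ?R (B2 n)"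
        by (rule measure_Un_le) auto
      ultimately show ?case using 1 2 3 by linarith
    qed
    show "(\<lambda>n. real n ^ k * exp (- L n) + real n ^ (k - 1) * exp (- L n) + exp (- a * L n)) \<longlonglongrightarrow> 0"
      unfolding L_def
      using tendsto_add[OF tendsto_add[OF power_times_exp_ln_square_tendsto_0[of k]
          power_times_exp_ln_square_tendsto_0[of "k - 1"]] exp_ln_square_tendsto_0[OF a]] by simp
  qed
  then show ?thesis by (simp add: L_def)
qed

section \<open>Translation into exponents of n\<close>

lemma asymptotically_almost_surely_mono:
  assumes "asymptotically_almost_surely M P" "\<forall>\<^sub>F n in sequentially. \<forall>x. P n x \<longrightarrow> Q n x"
  shows "asymptotically_almost_surely M Q"
  unfolding asymptotically_almost_surely_def
proof (rule tendsto_sandwich)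
  show "(\<lambda>n. measure_pmf.prob (M n) {x. P n x}) \<longlonglongrightarrow> 1"
    using assms(1) by (simp add: asymptotically_almost_surely_def)
  show "(\<lambda>_. 1) \<longlonglongrightarrow> (1::real)" by simp
  show "\<forall>\<^sub>F n in sequentially. measure_pmf.prob (M n) {x. Q n x} \<le> 1" by simp
  show "\<forall>\<^sub>F n in sequentially. measure_pmf.prob (M n) {x. P n x} \<le> measure_pmf.prob (M n) {x. Q n x}"
    using assms(2) by eventually_elim (auto intro!: measure_pmf.finite_measure_mono)
qed

theorem theorem1p5:
  fixes r k \<Delta> :: nat and T :: "'a set set"
  assumes "k \<ge> 2" and "r \<ge> k" and "\<Delta> = r - k"
    and "tight_tree k T" and "\<Inter>T = {}"
  shows "\<exists>(c::real) (C::real) (\<epsilon>1::nat \<Rightarrow> real) (\<epsilon>2::nat \<Rightarrow> real) (\<epsilon>3::nat \<Rightarrow> real).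
    0 < c \<and> c < C \<and> \<epsilon>1 \<longlonglongrightarrow> 0 \<and> \<epsilon>2 \<longlonglongrightarrow> 0 \<and> \<epsilon>3 \<longlonglongrightarrow> 0 \<and>
    (\<forall>p::nat \<Rightarrow> real. (\<forall>n. 0 \<le> p n \<and> p n \<le> 1) \<longrightarrow>
      ((\<forall>\<^sub>F n in sequentially. real n powr (- real \<Delta> + \<epsilon>1 n) \<le> p n) \<longrightarrow>
        asymptotically_almost_surely (\<lambda>n. random_hypergraph r n (p n))
          (\<lambda>n G. c * p n * real n ^ (r - 1) \<le> real (ex_number G (expansion r T)) \<and>
                 real (ex_number G (expansion r T)) \<le> C * p n * real n ^ (r - 1))) \<and>
      ((\<forall>\<^sub>F n in sequentially. real n powr (- real \<Delta> - 1 + \<epsilon>2 n) \<le> p n \<and>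
                              p n \<le> real n powr (- real \<Delta> + \<epsilon>1 n)) \<longrightarrow>
        asymptotically_almost_surely (\<lambda>n. random_hypergraph r n (p n))
          (\<lambda>n G. real n powr (real k - 1 - \<epsilon>3 n) \<le> real (ex_number G (expansion r T)) \<and>
                 real (ex_number G (expansion r T)) \<le> real n powr (real k - 1 + \<epsilon>3 n))))"
proof -
  define c where "c = 1 / (4 * (2 * real r) ^ (r - 1))"
  define m where "m = real (card (\<Union>(expansion r T)))"
  \<comment> \<open>Chosen so that \<open>n powr \<delta> n\<close> is log^2 n for
    \<open>ln n > 1\<close>. It serves as \<open>\<epsilon>1\<close> and \<open>\<epsilon>2\<close>;
    \<open>\<epsilon>3\<close> is twice as large, to accommodate the log^4 n of the sparse upper
    bound.\<close>
  define \<delta> where "\<delta> = (\<lambda>n::nat. 2 * ln (ln (real n)) / ln (real n))"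
  have c: "0 < c" using assms by (simp add: c_def)
  have \<delta>0: "\<delta> \<longlonglongrightarrow> 0" unfolding \<delta>_def by real_asymp
  have \<delta>20: "(\<lambda>n. 2 * \<delta> n) \<longlonglongrightarrow> 0" using tendsto_mult_left[OF \<delta>0, of 2] by simp
  have ev: "\<forall>\<^sub>F n in sequentially. 1 < ln (real n)" by real_asymp
  have pos: "0 < real n" if "1 < ln (real n)" for n
    using that by (cases "n = 0") auto
  have pd: "real n powr \<delta> n = (ln (real n))\<^sup>2" if "1 < ln (real n)" for n
  proof -
    have "real n powr \<delta> n = exp (2 * ln (ln (real n)))"
      using pos[OF that] that by (simp add: powr_def \<delta>_def)
    also have "\<dots> = (ln (real n))\<^sup>2" using that exp_of_nat_mult[of 2 "ln (ln (real n))"] by simp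
    finally show ?thesis .
  qed
  have scale: "real n powr (- real d + x) * real n ^ d = real n powr x" if "0 < real n" for n d x
    using that by (simp add: powr_add[symmetric] powr_realpow[symmetric])
  show ?thesis
  \<comment> \<open>Adding \<open>c + 1\<close> to the constant \<open>4 * m\<close> ensures
    \<open>c < C\<close> without comparing the two bounds.\<close>
  proof (rule exI[of _ c], rule exI[of _ "4 * m + c + 1"], rule exI[of _ \<delta>], rule exI[of _ \<delta>],
      rule exI[of _ "\<lambda>n. 2 * \<delta> n"], intro conjI allI impI)
    show "0 < c" by fact
    show "c < 4 * m + c + 1" by (simp add: m_def add_nonneg_pos)
    show "\<delta> \<longlonglongrightarrow> 0" "\<delta> \<longlonglongrightarrow> 0" "(\<lambda>n. 2 * \<delta> n) \<longlonglongrightarrow> 0" by fact+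
  next
    fix p :: "nat \<Rightarrow> real"
    assume p: "\<forall>n. 0 \<le> p n \<and> p n \<le> 1"
      and H: "\<forall>\<^sub>F n in sequentially. real n powr (- real \<Delta> + \<delta> n) \<le> p n"
    have "\<forall>\<^sub>F n in sequentially. (ln (real n))\<^sup>2 \<le> p n * real n ^ (r - k)"
      using H ev
    proof eventually_elim
      case (elim n)
      then have "real n powr (- real \<Delta> + \<delta> n) * real n ^ \<Delta> \<le> p n * real n ^ \<Delta>"
        by (intro mult_right_mono) auto
      then show ?case using scale pos pd elim assms(3) by simp
    qed
    from ex_number_random_dense[OF assms(1,2,4,5) _ _ this] p
    have "asymptotically_almost_surely (\<lambda>n. random_hypergraph r n (p n))
      (\<lambda>n G. c * p n * real n ^ (r - 1) \<le> real (ex_number G (expansion r T)) \<and>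
             real (ex_number G (expansion r T)) \<le> 4 * m * p n * real n ^ (r - 1))"
      by (simp add: c_def m_def)
    then show "asymptotically_almost_surely (\<lambda>n. random_hypergraph r n (p n))
      (\<lambda>n G. c * p n * real n ^ (r - 1) \<le> real (ex_number G (expansion r T)) \<and>
             real (ex_number G (expansion r T)) \<le> (4 * m + c + 1) * p n * real n ^ (r - 1))"
    proof (rule asymptotically_almost_surely_mono, intro always_eventually allI impI)
      fix n G
      assume *: "c * p n * real n ^ (r - 1) \<le> real (ex_number G (expansion r T)) \<and>
             real (ex_number G (expansion r T)) \<le> 4 * m * p n * real n ^ (r - 1)"
      have "4 * m * p n * real n ^ (r - 1) \<le> (4 * m + c + 1) * p n * real n ^ (r - 1)"
        using p c by (intro mult_right_mono) auto
      with * show "c * p n * real n ^ (r - 1) \<le> real (ex_number G (expansion r T)) \<and>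
             real (ex_number G (expansion r T)) \<le> (4 * m + c + 1) * p n * real n ^ (r - 1)"
        by linarith
    qed
  next
    fix p :: "nat \<Rightarrow> real"
    assume p: "\<forall>n. 0 \<le> p n \<and> p n \<le> 1"
      and H: "\<forall>\<^sub>F n in sequentially. real n powr (- real \<Delta> - 1 + \<delta> n) \<le> p n \<and>
                              p n \<le> real n powr (- real \<Delta> + \<delta> n)"
    \<comment> \<open>Lowering the set size from \<open>k\<close> to \<open>k - 1\<close> raises the
      exponent by one, matching the lower threshold for \<open>p\<close>.\<close>
    have d: "r - (k - 1) = Suc \<Delta>" using assms(1-3) by simp
    have large: "\<forall>\<^sub>F n in sequentially. (ln (real n))\<^sup>2 \<le> p n * real n ^ (r - (k - 1))"
      using H ev
    proof eventually_elim
      case (elim n)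
      then have "real n powr (- real (Suc \<Delta>) + \<delta> n) * real n ^ Suc \<Delta> \<le> p n * real n ^ Suc \<Delta>"
        by (intro mult_right_mono) (auto simp: algebra_simps)
      then show ?case using scale[of n "Suc \<Delta>"] pos pd elim d by simp
    qed
    have small: "\<forall>\<^sub>F n in sequentially. p n * real n ^ (r - k) \<le> (ln (real n))\<^sup>2"
      using H ev
    proof eventually_elim
      case (elim n)
      then have "p n * real n ^ \<Delta> \<le> real n powr (- real \<Delta> + \<delta> n) * real n ^ \<Delta>"
        by (intro mult_right_mono) auto
      then show ?case using scale pos pd elim assms(3) by simp
    qed
    have "asymptotically_almost_surely (\<lambda>n. random_hypergraph r n (p n))
      (\<lambda>n G. real n ^ (k - 1) / (ln (real n))\<^sup>2 \<le> real (ex_number G (expansion r T)) \<and>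
           real (ex_number G (expansion r T)) \<le> real n ^ (k - 1) * ((ln (real n))\<^sup>2)\<^sup>2)"
      using p by (intro ex_number_random_sparse[OF assms(1,2,4,5) _ _ large small]) auto
    then show "asymptotically_almost_surely (\<lambda>n. random_hypergraph r n (p n))
          (\<lambda>n G. real n powr (real k - 1 - 2 * \<delta> n) \<le> real (ex_number G (expansion r T)) \<and>
                 real (ex_number G (expansion r T)) \<le> real n powr (real k - 1 + 2 * \<delta> n))"
    proof (rule asymptotically_almost_surely_mono)
      show "\<forall>\<^sub>F n in sequentially. \<forall>G.
          real n ^ (k - 1) / (ln (real n))\<^sup>2 \<le> real (ex_number G (expansion r T)) \<and>
          real (ex_number G (expansion r T)) \<le> real n ^ (k - 1) * ((ln (real n))\<^sup>2)\<^sup>2 \<longrightarrow>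
          real n powr (real k - 1 - 2 * \<delta> n) \<le> real (ex_number G (expansion r T)) \<and>
          real (ex_number G (expansion r T)) \<le> real n powr (real k - 1 + 2 * \<delta> n)"
        using ev
      proof eventually_elim
        case (elim n)
        have k1: "real n powr (real k - 1) = real n ^ (k - 1)"
          using assms(1) pos[OF elim] by (simp add: powr_realpow[symmetric] of_nat_diff)
        have sq: "real n powr (2 * \<delta> n) = ((ln (real n))\<^sup>2)\<^sup>2"
          using pd[OF elim] powr_add[of "real n" "\<delta> n" "\<delta> n"] by (simp add: power2_eq_square)
        have "1 \<le> (ln (real n))\<^sup>2" using elim by simp
        \<comment> \<open>The lower bound is weakened from division by log^2 n to division by log^4
          n, so that the same \<open>\<epsilon>3\<close> works on both sides.\<close>
        then have "(ln (real n))\<^sup>2 \<le> ((ln (real n))\<^sup>2)\<^sup>2"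
          by (rule self_le_power) simp
        then have "real n ^ (k - 1) / ((ln (real n))\<^sup>2)\<^sup>2 \<le> real n ^ (k - 1) / (ln (real n))\<^sup>2"
          using elim by (intro divide_left_mono) auto
        moreover have "real n powr (real k - 1 - 2 * \<delta> n) = real n ^ (k - 1) / ((ln (real n))\<^sup>2)\<^sup>2"
          by (simp only: powr_diff[of "real n" "real k - 1"] k1 sq)
        moreover have "real n powr (real k - 1 + 2 * \<delta> n) = real n ^ (k - 1) * ((ln (real n))\<^sup>2)\<^sup>2"
          by (simp only: powr_add[of "real n" "real k - 1"] k1 sq)
        ultimately show ?case by (simp only:) (meson order_trans)
      qed
    qed
  qed
qed

end
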